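(* Let $C=\frac{1}{4\log_2(4/3)}$. Then, as $\epsilon\to 0^+$, \[\delta(\epsilon)\ \le\ \epsilon^{(C-o(1))\log_2(1/\epsilon)},\] i.e. there is a function $\theta(\epsilon)\to 0$ as $\epsilon\to 0^+$ such that $\delta(\epsilon)\le \epsilon^{(C-\theta(\epsilon))\log_2(1/\epsilon)}$ for all sufficiently small $\epsilon>0$.
   Context: For $\epsilon>0$, $\delta(\epsilon)$ denotes the best possible constant in the triangle removal lemma: the largest $\delta>0$ such that, for every $n\ge 1$, every $n$-vertex (simple) graph $G$ containing fewer than $\delta n^3$ triangles has a set of fewer than $\epsilon n^2$ edges which intersects every triangle of $G$. (The triangle removal lemma asserts that some such $\delta>0$ exists.) *)

theory Defs
  imports Complex_Main
begin

definition simple_graph :: "'a set \<Rightarrow> 'a set set \<Rightarrow> bool" where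
  "simple_graph V E \<longleftrightarrow> finite V \<and> E \<subseteq> {e. e \<subseteq> V \<and> card e = 2}"

text \<open>A triangle is represented by its vertex set. In a simple graph all edges have two
  elements, so the three vertices below are distinct; an edge \<open>e\<close> belongs to the
  triangle \<open>T\<close> iff \<open>e \<subseteq> T\<close>.\<close>

definition triangles :: "'a set set \<Rightarrow> 'a set set" where
  "triangles E = {{x, y, z} | x y z. {x, y} \<in> E \<and> {y, z} \<in> E \<and> {x, z} \<in> E}"

definition removal_property :: "real \<Rightarrow> real \<Rightarrow> bool" where
  "removal_property \<epsilon> \<delta> \<longleftrightarrow>
    (\<forall>n\<ge>1. \<forall>(V :: nat set) E.
      simple_graph V E \<and> card V = n \<and> real (card (triangles E)) < \<delta> * real n ^ 3 \<longrightarrow>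
      (\<exists>F\<subseteq>E. real (card F) < \<epsilon> * real n ^ 2 \<and> (\<forall>T\<in>triangles E. \<exists>e\<in>F. e \<subseteq> T)))"

text \<open>The largest admissible \<open>\<delta>\<close>. Positivity of \<open>\<delta>\<close> is not imposed, so that for small
  \<open>\<epsilon>\<close> the maximum exists without appeal to the triangle removal lemma (any \<open>\<delta> \<le> 0\<close> is
  trivially admissible). As soon as some \<open>\<delta> > 0\<close> is admissible, which is what the
  triangle removal lemma asserts, this is the largest admissible \<open>\<delta> > 0\<close>; see
  \<open>removal_const_eq_greatest_pos\<close> below. For large \<open>\<epsilon>\<close> (for example \<open>\<epsilon> > 1/2\<close>) every
  \<open>\<delta>\<close> is admissible, there is no largest one, and the value is unspecified; only the
  behaviour as \<open>\<epsilon>\<close> tends to \<open>0\<close> from the right is meaningful.\<close>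

definition removal_const :: "real \<Rightarrow> real" where
  "removal_const \<epsilon> = (GREATEST \<delta>. removal_property \<epsilon> \<delta>)"

lemma removal_propertyD:
  fixes V :: "nat set"
  assumes "removal_property \<epsilon> \<delta>" "1 \<le> n" "simple_graph V E" "card V = n"
    and "real (card (triangles E)) < \<delta> * real n ^ 3"
  shows "\<exists>F\<subseteq>E. real (card F) < \<epsilon> * real n ^ 2 \<and> (\<forall>T\<in>triangles E. \<exists>e\<in>F. e \<subseteq> T)"
  using assms(1)[unfolded removal_property_def, rule_format, of n V E] assms(2-) by simp

lemma removal_property_nonpos:
  assumes "\<delta> \<le> 0"
  shows "removal_property \<epsilon> \<delta>"
proof -
  have "\<not> real (card (triangles E)) < \<delta> * real n ^ 3" for E :: "nat set set" and n
    using mult_nonpos_nonneg[OF assms, of "real n ^ 3"] by (simp add: not_less order_trans)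
  then show ?thesis
    unfolding removal_property_def by blast
qed

lemma removal_property_bounded:
  assumes "\<epsilon> \<le> 1/9" "removal_property \<epsilon> \<delta>"
  shows "\<delta> \<le> 1/27"
proof (rule ccontr)
  assume "\<not> \<delta> \<le> 1/27"
  define V where "V = {0, 1, 2::nat}"
  define E where "E = {{0, 1}, {1, 2}, {0, 2::nat}}"
  have G: "simple_graph V E" "card V = 3"
    by (auto simp: simple_graph_def V_def E_def card_insert_if)
  have sub: "triangles E \<subseteq> {V}"
  proof
    fix T assume "T \<in> triangles E"
    then obtain x y z where T: "T = {x, y, z}" and
      edges: "{x, y} \<in> E" "{y, z} \<in> E" "{x, z} \<in> E"
      unfolding triangles_def by blast
    have edge: "e \<subseteq> V \<and> card e = 2" if "e \<in> E" for e
      using G(1) that unfolding simple_graph_def by blast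
    have "x \<noteq> y" "y \<noteq> z" "x \<noteq> z"
      using edge[OF edges(1)] edge[OF edges(2)] edge[OF edges(3)] by auto
    then have "card T = card V"
      using T G(2) by simp
    moreover have "T \<subseteq> V"
      using T edge[OF edges(1)] edge[OF edges(2)] by simp
    ultimately have "T = V"
      by (intro card_subset_eq) (simp_all add: V_def)
    then show "T \<in> {V}"
      by simp
  qed
  have V: "V \<in> triangles E"
    unfolding triangles_def V_def mem_Collect_eq
    by (intro exI[of _ 0] exI[of _ 1] exI[of _ 2]) (simp add: E_def)
  have "card (triangles E) \<le> 1"
    using card_mono[OF _ sub] by simp
  then have "real (card (triangles E)) < \<delta> * real 3 ^ 3"
    using \<open>\<not> \<delta> \<le> 1/27\<close> by simp
  then obtain F where F: "F \<subseteq> E" "real (card F) < \<epsilon> * real 3 ^ 2"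
      "\<forall>T\<in>triangles E. \<exists>e\<in>F. e \<subseteq> T"
    using removal_propertyD[OF assms(2), of 3 V E] G by auto
  have "finite F"
    using F(1) by (rule finite_subset) (simp add: E_def)
  moreover have "card F = 0"
    using F(2) assms(1) by simp
  ultimately have "F = {}"
    by simp
  then show False
    using F(3) V by blast
qed

lemma removal_property_mono:
  assumes "removal_property \<epsilon> \<delta>" "\<delta>' \<le> \<delta>"
  shows "removal_property \<epsilon> \<delta>'"
proof -
  have le: "\<delta>' * real n ^ 3 \<le> \<delta> * real n ^ 3" for n
    using assms(2) by (simp add: mult_right_mono)
  show ?thesis
    unfolding removal_property_def
  proof (intro allI impI, elim conjE)
    fix n :: nat and V :: "nat set" and E
    assume n: "1 \<le> n" and G: "simple_graph V E" "card V = n"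
      and "real (card (triangles E)) < \<delta>' * real n ^ 3"
    then have "real (card (triangles E)) < \<delta> * real n ^ 3"
      using le[of n] by linarith
    then show "\<exists>F\<subseteq>E. real (card F) < \<epsilon> * real n ^ 2 \<and> (\<forall>T\<in>triangles E. \<exists>e\<in>F. e \<subseteq> T)"
      by (rule removal_propertyD[OF assms(1) n G])
  qed
qed

lemma removal_const_greatest:
  assumes "\<epsilon> \<le> 1/9"
  shows "removal_property \<epsilon> (removal_const \<epsilon>)"
    and "removal_property \<epsilon> \<delta> \<Longrightarrow> \<delta> \<le> removal_const \<epsilon>"
proof -
  define S where "S = {\<delta>. removal_property \<epsilon> \<delta>}"
  have bdd: "bdd_above S"
    using removal_property_bounded[OF assms] unfolding S_def by (intro bdd_aboveI[of _ "1/27"]) blast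
  have ne: "S \<noteq> {}"
    using removal_property_nonpos[of 0 \<epsilon>] unfolding S_def by auto
  have Sup: "removal_property \<epsilon> (Sup S)"
    unfolding removal_property_def
  proof (intro allI impI, elim conjE)
    fix n :: nat and V :: "nat set" and E
    assume n: "1 \<le> n" and G: "simple_graph V E" "card V = n"
      and less: "real (card (triangles E)) < Sup S * real n ^ 3"
    have pos: "real n ^ 3 > 0"
      using n by simp
    have "real (card (triangles E)) / real n ^ 3 < Sup S"
      using less pos by (simp add: pos_divide_less_eq)
    then obtain d where d: "d \<in> S" "real (card (triangles E)) / real n ^ 3 < d"
      using less_cSup_iff[OF ne bdd] by blast
    have "real (card (triangles E)) < d * real n ^ 3"
      using d(2) pos by (simp add: pos_divide_less_eq)
    with d(1) show "\<exists>F\<subseteq>E. real (card F) < \<epsilon> * real n ^ 2 \<and> (\<forall>T\<in>triangles E. \<exists>e\<in>F. e \<subseteq> T)"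
      unfolding S_def mem_Collect_eq by (intro removal_propertyD[OF _ n G])
  qed
  have ub: "\<And>\<delta>. removal_property \<epsilon> \<delta> \<Longrightarrow> \<delta> \<le> Sup S"
    using bdd by (auto simp: S_def intro: cSup_upper)
  have "removal_const \<epsilon> = Sup S"
    unfolding removal_const_def by (rule Greatest_equality) (use Sup ub in auto)
  then show "removal_property \<epsilon> (removal_const \<epsilon>)"
    and "removal_property \<epsilon> \<delta> \<Longrightarrow> \<delta> \<le> removal_const \<epsilon>"
    using Sup ub by auto
qed

lemma removal_const_eq_greatest_pos:
  assumes "\<epsilon> \<le> 1/9" "\<exists>\<delta>>0. removal_property \<epsilon> \<delta>"
  shows "removal_const \<epsilon> = (GREATEST \<delta>. 0 < \<delta> \<and> removal_property \<epsilon> \<delta>)"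
proof (rule Greatest_equality[symmetric])
  obtain \<delta> where "0 < \<delta>" "removal_property \<epsilon> \<delta>"
    using assms(2) by blast
  then have "0 < removal_const \<epsilon>"
    using removal_const_greatest(2)[OF assms(1), of \<delta>] by linarith
  then show "0 < removal_const \<epsilon> \<and> removal_property \<epsilon> (removal_const \<epsilon>)"
    using removal_const_greatest(1)[OF assms(1)] by blast
qed (use removal_const_greatest(2)[OF assms(1)] in blast)

end

theory Submission
  imports Defs "HOL-Library.FuncSet" "HOL-Combinatorics.Transposition" "HOL-Real_Asymp.Real_Asymp"
begin

text \<open>
  The bound comes from a graph with few triangles, all of them edge-disjoint, in the spirit of
  Behrend's construction. Let \<open>B\<close> be the set of integer points in a ball of radius \<open>R\<close> in
  dimension \<open>D\<close>, with \<open>N\<close> points, and take three copies of \<open>B\<close> as vertex classes. Fix \<open>r\<close> and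
  consider the triples \<open>(x, y, x + y)\<close> in \<open>B\<close> with \<open>\<parallel>x - y\<parallel>\<^sup>2 = r\<close>; their pairs are the edges. Three edges
  on \<open>x\<close>, \<open>y\<close>, \<open>z\<close> satisfy \<open>\<parallel>x - y\<parallel> = \<parallel>z - 2 y\<parallel> = \<parallel>2 x - z\<parallel>\<close>, and the parallelogram law then
  gives \<open>z = x + y\<close> (\<open>sum_triples_at_uniq\<close>). So the triangles are exactly the chosen triples, at
  most \<open>N\<^sup>2\<close> of them among \<open>3 N\<close> vertices, and they are edge-disjoint: as many edges as there are
  triples are needed to destroy them, and \<open>\<delta>(\<epsilon>)\<close> is at most about \<open>1 / N\<close> when \<open>\<epsilon>\<close> is the number of triples
  divided by \<open>9 N\<^sup>2\<close> (\<open>removal_bound_of_triples\<close>).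

  At a suitable scale \<open>R\<close>, a random pair of points of \<open>B\<close> has its sum in \<open>B\<close> with probability at least
  \<open>3/4\<close> to the power \<open>D/2 + o(D)\<close>: for \<open>z\<close> in \<open>B\<close>, at least half of the points of a ball of radius
  almost \<open>sqrt (3/4) * R\<close> around \<open>z / 2\<close> lie in both \<open>B\<close> and \<open>z - B\<close>, by Chebyshev's inequality for the inner
  product with \<open>z\<close> (\<open>card_representations_lattice_ball\<close>). The ratio of the numbers of lattice points
  of the two balls is controlled at some scale by a pigeonhole argument
  (\<open>lattice_ball_good_scale\<close>). There are at most \<open>4 R\<^sup>2 + 1\<close> possible values of \<open>r\<close>, so choosing
  the most popular one costs a further factor of order \<open>R\<^sup>2\<close>.

  Let \<open>a = log 2 (4/3)\<close> and \<open>R\<^sup>2 = (4/3)\<close> to the power \<open>D/2 + o(D)\<close>. These counts allow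
  \<open>log 2 (1/\<epsilon>) = a D + o(D)\<close>, while
  \<open>log 2 N\<close> is at least \<open>D * log 2 (R / sqrt D)\<close>, which is \<open>a D\<^sup>2 / 4\<close> up to lower order terms. The
  quotient \<open>log 2 N / (log 2 (1/\<epsilon>))\<^sup>2\<close> tends to \<open>1 / (4 a)\<close>, the constant of the theorem.
\<close>

section \<open>Graphs with edge-disjoint triangles\<close>

text \<open>The edge set of the tripartite graph on three copies of the domain of \<open>h\<close> in which each
  triple \<open>(x, y, z) \<in> S\<close> contributes the three edges of a triangle. Vertices have to be natural
  numbers; the injective labelling \<open>h\<close> turns an element \<open>v\<close> of the three copies into \<open>3 * h v\<close>,
  \<open>3 * h v + 1\<close> and \<open>3 * h v + 2\<close>, so the part of a vertex is its residue modulo 3.\<close>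

definition triple_edges :: "('a \<Rightarrow> nat) \<Rightarrow> ('a \<times> 'a \<times> 'a) set \<Rightarrow> nat set set" where
  "triple_edges h S =
    (\<Union>(x, y, z)\<in>S. {{3 * h x, 3 * h y + 1}, {3 * h y + 1, 3 * h z + 2}, {3 * h x, 3 * h z + 2}})"

lemma triple_edges_mod:
  assumes "{u, v} \<in> triple_edges h S"
  shows "u mod 3 \<noteq> v mod 3"
proof -
  have "3 * i \<noteq> Suc (3 * j)" "3 * i \<noteq> Suc (Suc (3 * j))" for i j :: nat by presburger+
  then show ?thesis
    using assms by (auto simp: triple_edges_def doubleton_eq_iff mod_Suc)
qed

lemma triple_edges_cases:
  shows "{3 * i, 3 * j + 1} \<in> triple_edges h S \<longleftrightarrow> (\<exists>(x, y, z)\<in>S. h x = i \<and> h y = j)"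
    and "{3 * j + 1, 3 * k + 2} \<in> triple_edges h S \<longleftrightarrow> (\<exists>(x, y, z)\<in>S. h y = j \<and> h z = k)"
    and "{3 * i, 3 * k + 2} \<in> triple_edges h S \<longleftrightarrow> (\<exists>(x, y, z)\<in>S. h x = i \<and> h z = k)"
proof -
  have ne: "3 * i \<noteq> Suc (3 * j)" "3 * i \<noteq> Suc (Suc (3 * j))" for i j :: nat by presburger+
  show "{3 * i, 3 * j + 1} \<in> triple_edges h S \<longleftrightarrow> (\<exists>(x, y, z)\<in>S. h x = i \<and> h y = j)"
    by (simp add: triple_edges_def doubleton_eq_iff ne ne[symmetric] split_beta eq_commute)
  show "{3 * j + 1, 3 * k + 2} \<in> triple_edges h S \<longleftrightarrow> (\<exists>(x, y, z)\<in>S. h y = j \<and> h z = k)"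
    by (simp add: triple_edges_def doubleton_eq_iff ne ne[symmetric] split_beta eq_commute)
  show "{3 * i, 3 * k + 2} \<in> triple_edges h S \<longleftrightarrow> (\<exists>(x, y, z)\<in>S. h x = i \<and> h z = k)"
    by (simp add: triple_edges_def doubleton_eq_iff ne ne[symmetric] split_beta eq_commute)
qed

lemma triangle_in_triple_edges:
  assumes "T \<in> triangles (triple_edges h S)"
  obtains i j k where "T = {3 * i, 3 * j + 1, 3 * k + 2}"
    "{3 * i, 3 * j + 1} \<in> triple_edges h S" "{3 * j + 1, 3 * k + 2} \<in> triple_edges h S"
    "{3 * i, 3 * k + 2} \<in> triple_edges h S"
proof -
  let ?E = "triple_edges h S"
  obtain x y z where T: "T = {x, y, z}" and e: "{x, y} \<in> ?E" "{y, z} \<in> ?E" "{x, z} \<in> ?E"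
    using assms unfolding triangles_def by blast
  have e': "{y, x} \<in> ?E" "{z, y} \<in> ?E" "{z, x} \<in> ?E"
    using e by (simp_all add: insert_commute)
  have "\<exists>u v w. T = {u, v, w} \<and> u mod 3 = 0 \<and> v mod 3 = 1 \<and> w mod 3 = 2 \<and>
      {u, v} \<in> ?E \<and> {v, w} \<in> ?E \<and> {u, w} \<in> ?E"
  proof -
    have "x mod 3 \<noteq> y mod 3" "y mod 3 \<noteq> z mod 3" "x mod 3 \<noteq> z mod 3"
      using e triple_edges_mod by blast+
    moreover have "u mod 3 = 0 \<or> u mod 3 = 1 \<or> u mod 3 = 2" for u :: nat by presburger
    ultimately consider
        "x mod 3 = 0" "y mod 3 = 1" "z mod 3 = 2" | "x mod 3 = 0" "z mod 3 = 1" "y mod 3 = 2"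
      | "y mod 3 = 0" "x mod 3 = 1" "z mod 3 = 2" | "y mod 3 = 0" "z mod 3 = 1" "x mod 3 = 2"
      | "z mod 3 = 0" "x mod 3 = 1" "y mod 3 = 2" | "z mod 3 = 0" "y mod 3 = 1" "x mod 3 = 2"
      by metis
    then show ?thesis
    proof cases
      case 1
      then show ?thesis using T e e'
        by (intro exI[of _ x] exI[of _ y] exI[of _ z]) (simp add: insert_commute)
    next
      case 2
      then show ?thesis using T e e'
        by (intro exI[of _ x] exI[of _ z] exI[of _ y]) (simp add: insert_commute)
    next
      case 3
      then show ?thesis using T e e'
        by (intro exI[of _ y] exI[of _ x] exI[of _ z]) (simp add: insert_commute)
    next
      case 4
      then show ?thesis using T e e'
        by (intro exI[of _ y] exI[of _ z] exI[of _ x]) (simp add: insert_commute)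
    next
      case 5
      then show ?thesis using T e e'
        by (intro exI[of _ z] exI[of _ x] exI[of _ y]) (simp add: insert_commute)
    next
      case 6
      then show ?thesis using T e e'
        by (intro exI[of _ z] exI[of _ y] exI[of _ x]) (simp add: insert_commute)
    qed
  qed
  then obtain u v w where uvw: "T = {u, v, w}" "u mod 3 = 0" "v mod 3 = 1" "w mod 3 = 2"
      "{u, v} \<in> ?E" "{v, w} \<in> ?E" "{u, w} \<in> ?E"
    by (elim exE conjE) (rule that)
  obtain i where i: "u = 3 * i" using uvw(2) by (metis mod_0_imp_dvd dvdE)
  obtain j where j: "v = 3 * j + 1" using uvw(3) by (metis mult_div_mod_eq)
  obtain k where k: "w = 3 * k + 2" using uvw(4) by (metis mult_div_mod_eq)
  show ?thesis using uvw unfolding i j k by (intro that)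
qed

text \<open>The hypothesis \<open>uniq\<close> says that any three edges closing up to a triangle come from a single
  triple. It makes the triangles of the graph correspond to \<open>S\<close> and be pairwise edge-disjoint,
  so destroying all of them takes at least \<open>card S\<close> edges.\<close>

lemma removal_bound_of_triples:
  fixes B :: "'a set"
  assumes B: "finite B" "B \<noteq> {}" and S: "S \<subseteq> B \<times> B \<times> B"
    and uniq: "\<And>x y z x' y' z'. (x, y, z') \<in> S \<Longrightarrow> (x', y, z) \<in> S \<Longrightarrow> (x, y', z) \<in> S
      \<Longrightarrow> x' = x \<and> y' = y \<and> z' = z"
    and rem: "removal_property \<epsilon> \<delta>" and large: "\<epsilon> * (3 * real (card B))^2 \<le> real (card S)"
  shows "\<delta> * (3 * real (card B))^3 \<le> real (card S)"
proof (rule ccontr)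
  assume neg: "\<not> ?thesis"
  obtain h where h: "bij_betw h B {0..<card B}"
    using ex_bij_betw_finite_nat[OF B(1)] by blast
  have inj: "h x = h x' \<longleftrightarrow> x = x'" if "x \<in> B" "x' \<in> B" for x x'
    using h that by (auto simp: bij_betw_def inj_on_def)
  have lt: "h x < card B" if "x \<in> B" for x
    using h that by (auto simp: bij_betw_def)
  define E where "E = triple_edges h S"
  define tri where "tri = (\<lambda>(x, y, z). {3 * h x, 3 * h y + 1, 3 * h z + 2})"
  have finS: "finite S" using S B(1) by (meson finite_SigmaI finite_subset)
  have ne: "3 * i \<noteq> Suc (3 * j)" "3 * i \<noteq> Suc (Suc (3 * j))" "Suc (3 * j) \<noteq> 3 * i"
    "Suc (Suc (3 * j)) \<noteq> 3 * i" for i j :: nat by presburger+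
  have graph: "simple_graph {..<3 * card B} E"
    unfolding simple_graph_def
  proof (intro conjI subsetI)
    fix e assume "e \<in> E"
    then obtain x y z where xyz: "(x, y, z) \<in> S"
      "e \<in> {{3 * h x, 3 * h y + 1}, {3 * h y + 1, 3 * h z + 2}, {3 * h x, 3 * h z + 2}}"
      unfolding E_def triple_edges_def by blast
    have "x \<in> B" "y \<in> B" "z \<in> B" using xyz(1) S by auto
    from this[THEN lt] show "e \<in> {e. e \<subseteq> {..<3 * card B} \<and> card e = 2}"
      using xyz(2) ne by (auto simp: card_insert_if)
  qed simp
  have sub: "triangles E \<subseteq> tri ` S"
  proof
    fix T assume "T \<in> triangles E"
    then obtain i j k where T: "T = {3 * i, 3 * j + 1, 3 * k + 2}" "{3 * i, 3 * j + 1} \<in> E"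
      "{3 * j + 1, 3 * k + 2} \<in> E" "{3 * i, 3 * k + 2} \<in> E"
      unfolding E_def by (elim triangle_in_triple_edges)
    then obtain x y z x' y' z' x'' y'' z'' where
      *: "(x, y, z'') \<in> S" "h x = i" "h y = j" "(x'', y', z) \<in> S" "h y' = j" "h z = k"
         "(x', y'', z') \<in> S" "h x' = i" "h z' = k"
      unfolding E_def triple_edges_cases by blast
    then have "x' = x" "y' = y" "z' = z" using S inj by auto
    with * have "(x, y, z) \<in> S" using uniq[of x y z'' x'' z y''] by auto
    then show "T \<in> tri ` S" using * T(1) by (force simp: tri_def)
  qed
  have tri: "tri s \<in> triangles E" if "s \<in> S" for s
  proof -
    obtain x y z where s: "s = (x, y, z)" by (cases s)
    have "{3 * h x, 3 * h y + 1} \<in> E" "{3 * h y + 1, 3 * h z + 2} \<in> E" "{3 * h x, 3 * h z + 2} \<in> E"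
      using that unfolding s E_def triple_edges_cases by auto
    then show ?thesis unfolding s triangles_def tri_def by auto
  qed
  have "card (triangles E) \<le> card S"
    using card_mono[OF _ sub] finS card_image_le[OF finS, of tri] by fastforce
  then have "real (card (triangles E)) < \<delta> * real (3 * card B) ^ 3"
    using neg by simp
  then obtain F where F: "F \<subseteq> E" "real (card F) < \<epsilon> * real (3 * card B) ^ 2"
      "\<forall>T\<in>triangles E. \<exists>e\<in>F. e \<subseteq> T"
    using removal_propertyD[OF rem _ graph, of "3 * card B"] B
    by (auto simp: Suc_le_eq card_gt_0_iff)
  have "\<exists>e\<in>F. e \<subseteq> tri s" if "s \<in> S" for s using F(3) tri[OF that] by blast
  then obtain f where f: "\<And>s. s \<in> S \<Longrightarrow> f s \<in> F \<and> f s \<subseteq> tri s" by metis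
  have finF: "finite F"
    using F(1) finS unfolding E_def triple_edges_def by (auto intro: finite_subset)
  have edge_disjoint: "s = t" if s: "s \<in> S" and t: "t \<in> S" and e: "e \<in> E" "e \<subseteq> tri s" "e \<subseteq> tri t" for s t e
  proof -
    obtain x y z where s': "s = (x, y, z)" by (cases s)
    obtain x' y' z' where t': "t = (x', y', z')" by (cases t)
    obtain u v w where uvw: "(u, v, w) \<in> S"
      "e \<in> {{3 * h u, 3 * h v + 1}, {3 * h v + 1, 3 * h w + 2}, {3 * h u, 3 * h w + 2}}"
      using e(1) unfolding E_def triple_edges_def by blast
    have "h x = h x' \<and> h y = h y' \<or> h y = h y' \<and> h z = h z' \<or> h x = h x' \<and> h z = h z'"
      using uvw(2) e(2,3) ne unfolding s' t' tri_def by auto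
    then have "x = x' \<and> y = y' \<or> y = y' \<and> z = z' \<or> x = x' \<and> z = z'"
      using s t S inj unfolding s' t' by auto
    \<comment> \<open>two common coordinates determine the third: apply \<open>uniq\<close> with one triple used twice\<close>
    then show ?thesis
    proof (elim disjE conjE)
      assume "x = x'" "y = y'"
      then show ?thesis using uniq[of x y z' x z y] s t unfolding s' t' by blast
    next
      assume "y = y'" "z = z'"
      then show ?thesis using uniq[of x y z x' z y] s t unfolding s' t' by blast
    next
      assume "x = x'" "z = z'"
      then show ?thesis using uniq[of x y z x z y'] s t unfolding s' t' by blast
    qed
  qed
  have "inj_on f S"
    using f F(1) by (intro inj_onI) (metis edge_disjoint subsetD)
  then have "card S \<le> card F"
    using f finF by (intro card_inj_on_le) auto
  then show False using F(2) large by simp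
qed

section \<open>Lattice points in balls\<close>

text \<open>Integer vectors of dimension \<open>D\<close> are functions \<open>nat \<Rightarrow> int\<close> that vanish from index \<open>D\<close> on, so that
  \<open>D\<close> can vary and sums and differences are taken pointwise. \<open>normsq\<close> is the squared Euclidean
  norm.\<close>

definition normsq :: "nat \<Rightarrow> (nat \<Rightarrow> int) \<Rightarrow> int" where
  "normsq D x = (\<Sum>i<D. (x i)\<^sup>2)"

lemma normsq_add: "normsq D (\<lambda>i. x i + y i) = normsq D x + normsq D y + 2 * (\<Sum>i<D. x i * y i)"
  by (simp add: normsq_def power2_sum sum.distrib sum_distrib_left mult.assoc)

lemma normsq_diff: "normsq D (\<lambda>i. x i - y i) = normsq D x + normsq D y - 2 * (\<Sum>i<D. x i * y i)"
  by (simp add: normsq_def power2_diff sum.distrib sum_subtractf sum_distrib_left mult.assoc)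

lemma normsq_nonneg: "0 \<le> normsq D x"
  by (simp add: normsq_def sum_nonneg)

lemma parallelogram_normsq:
  "normsq D (\<lambda>i. x i + y i) + normsq D (\<lambda>i. x i - y i) = 2 * normsq D x + 2 * normsq D y"
  by (simp add: normsq_add normsq_diff)

text \<open>The integer points in the ball of squared radius \<open>k\<close>.\<close>

definition lattice_ball :: "nat \<Rightarrow> real \<Rightarrow> (nat \<Rightarrow> int) set" where
  "lattice_ball D k = {x. (\<forall>i\<ge>D. x i = 0) \<and> real_of_int (normsq D x) \<le> k}"

lemma card_box:
  "card {x. (\<forall>i<D. x i \<in> A) \<and> (\<forall>i\<ge>D. x i = 0)} = card A ^ D"
  (is "card ?S = _")
  and finite_box: "finite A \<Longrightarrow> finite {x. (\<forall>i<D. x i \<in> A) \<and> (\<forall>i\<ge>D. x i = (0::int))}"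
proof -
  have bij: "bij_betw (\<lambda>x. restrict x {..<D}) ?S (PiE {..<D} (\<lambda>_. A))"
    by (rule bij_betw_byWitness[where f' = "\<lambda>f i. if i < D then f i else 0"])
      (auto simp: fun_eq_iff PiE_def extensional_def Pi_def)
  show "card ?S = card A ^ D"
    using bij_betw_same_card[OF bij] by (simp add: card_PiE)
  show "finite A \<Longrightarrow> finite ?S"
    using bij_betw_finite[OF bij] by (simp add: finite_PiE)
qed

lemma abs_le_of_mem_lattice_ball:
  assumes "x \<in> lattice_ball D k" "i < D"
  shows "\<bar>real_of_int (x i)\<bar> \<le> sqrt k"
proof -
  have "(x i)\<^sup>2 \<le> normsq D x"
    unfolding normsq_def using assms(2) by (intro member_le_sum) auto
  then have "real_of_int ((x i)\<^sup>2) \<le> real_of_int (normsq D x)" by (simp only: of_int_le_iff)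
  then have "(real_of_int (x i))\<^sup>2 \<le> k"
    using assms(1) unfolding lattice_ball_def mem_Collect_eq of_int_power by linarith
  then show ?thesis
    by (metis real_sqrt_abs real_sqrt_le_iff)
qed

lemma lattice_ball_subset_box:
  "lattice_ball D k \<subseteq> {x. (\<forall>i<D. x i \<in> {-\<lfloor>sqrt k\<rfloor>..\<lfloor>sqrt k\<rfloor>}) \<and> (\<forall>i\<ge>D. x i = 0)}"
proof -
  have "x i \<in> {-\<lfloor>sqrt k\<rfloor>..\<lfloor>sqrt k\<rfloor>}" if "x \<in> lattice_ball D k" "i < D" for x i
    using abs_le_of_mem_lattice_ball[OF that] by (auto simp: le_floor_iff minus_le_iff[of "\<lfloor>sqrt k\<rfloor>"])
  then show ?thesis by (auto simp: lattice_ball_def)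
qed

lemma finite_lattice_ball [simp]: "finite (lattice_ball D k)"
  by (rule finite_subset[OF lattice_ball_subset_box finite_box]) simp

lemma card_lattice_ball_le:
  assumes "1 \<le> k"
  shows "real (card (lattice_ball D k)) \<le> (3 * sqrt k) ^ D"
proof -
  let ?s = "\<lfloor>sqrt k\<rfloor>"
  have s: "0 \<le> ?s" "real_of_int ?s \<le> sqrt k" "1 \<le> sqrt k" using assms by auto
  have "card (lattice_ball D k) \<le> card {-?s..?s} ^ D"
    unfolding card_box[symmetric] by (intro card_mono finite_box lattice_ball_subset_box) simp
  then have "real (card (lattice_ball D k)) \<le> real (card {-?s..?s}) ^ D"
    by (metis of_nat_le_iff of_nat_power)
  also have "real (card {-?s..?s}) = 2 * real_of_int ?s + 1" using s(1) by simp
  then have "real (card {-?s..?s}) \<le> 3 * sqrt k" using s(2,3) by linarith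
  then have "real (card {-?s..?s}) ^ D \<le> (3 * sqrt k) ^ D" by (intro power_mono) auto
  finally show ?thesis .
qed

lemma card_lattice_ball_ge:
  assumes "0 \<le> k"
  shows "sqrt (k / real D) ^ D \<le> real (card (lattice_ball D k))"
proof (cases "D = 0")
  case True
  then have "lattice_ball D k = {\<lambda>_. 0}" using assms by (auto simp: lattice_ball_def normsq_def)
  then show ?thesis using True by simp
next
  case False
  let ?s = "\<lfloor>sqrt (k / real D)\<rfloor>"
  have s: "0 \<le> ?s" using assms by simp
  have sub: "{x. (\<forall>i<D. x i \<in> {-?s..?s}) \<and> (\<forall>i\<ge>D. x i = 0)} \<subseteq> lattice_ball D k"
  proof (clarsimp simp: lattice_ball_def)
    fix x assume x: "\<forall>i<D. - ?s \<le> x i \<and> x i \<le> ?s"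
    have "normsq D x \<le> (\<Sum>i<D. ?s\<^sup>2)"
      unfolding normsq_def using x s by (intro sum_mono abs_le_square_iff[THEN iffD1]) auto
    then have "real_of_int (normsq D x) \<le> real_of_int (\<Sum>i<D. ?s\<^sup>2)" by (simp only: of_int_le_iff)
    also have "\<dots> = real D * (real_of_int ?s)\<^sup>2" by simp
    also have "\<dots> \<le> real D * (sqrt (k / real D))\<^sup>2"
      using s by (intro mult_left_mono power_mono) auto
    also have "\<dots> = k" using assms False by simp
    finally show "real_of_int (normsq D x) \<le> k" .
  qed
  have "card {-?s..?s} ^ D \<le> card (lattice_ball D k)"
    unfolding card_box[symmetric] by (intro card_mono sub) simp
  then have "real (card {-?s..?s}) ^ D \<le> real (card (lattice_ball D k))"
    by (metis of_nat_le_iff of_nat_power)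
  moreover have "real (card {-?s..?s}) = 2 * real_of_int ?s + 1" using s by simp
  then have "sqrt (k / real D) \<le> real (card {-?s..?s})"
    using s real_of_int_floor_add_one_gt[of "sqrt (k / real D)"] by linarith
  then have "sqrt (k / real D) ^ D \<le> real (card {-?s..?s}) ^ D" using assms by (intro power_mono) auto
  ultimately show ?thesis by linarith
qed

text \<open>The ball is invariant under sign changes and permutations of the coordinates. Hence distinct
  coordinates of its points are uncorrelated, all coordinates have the same second moment, and the
  second moment of a linear form is determined by the norm of its coefficient vector.\<close>

lemma sum_mult_coords_lattice_ball:
  assumes "i < D" "j < D" "i \<noteq> j"
  shows "(\<Sum>w\<in>lattice_ball D k. w i * w j) = 0"
proof -
  let ?T = "\<lambda>w::nat \<Rightarrow> int. w(i := - w i)"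
  have n: "normsq D (?T w) = normsq D w" for w
    unfolding normsq_def by (intro sum.cong) auto
  have T: "?T w \<in> lattice_ball D k" if "w \<in> lattice_ball D k" for w
    using that assms n by (auto simp: lattice_ball_def)
  have "(\<Sum>w\<in>lattice_ball D k. w i * w j) = (\<Sum>w\<in>lattice_ball D k. - (w i * w j))"
    by (rule sum.reindex_bij_witness[where i = ?T and j = ?T]) (use T assms in auto)
  then show ?thesis by (simp add: sum_negf)
qed

lemma sum_square_coord_lattice_ball:
  assumes "i < D"
  shows "int D * (\<Sum>w\<in>lattice_ball D k. (w i)\<^sup>2) = (\<Sum>w\<in>lattice_ball D k. normsq D w)"
proof -
  have eq: "(\<Sum>w\<in>lattice_ball D k. (w i)\<^sup>2) = (\<Sum>w\<in>lattice_ball D k. (w j)\<^sup>2)" if "j < D" for j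
  proof -
    let ?T = "\<lambda>w::nat \<Rightarrow> int. w \<circ> transpose i j"
    have bij: "bij_betw (transpose i j) {..<D} {..<D}"
      using assms that by (intro bij_betw_byWitness[where f' = "transpose i j"]) (auto simp: transpose_def)
    have n: "normsq D (?T w) = normsq D w" for w
      unfolding normsq_def using sum.reindex_bij_betw[OF bij, of "\<lambda>i. (w i)\<^sup>2"] by simp
    have T: "?T w \<in> lattice_ball D k" if "w \<in> lattice_ball D k" for w
      using that assms \<open>j < D\<close> unfolding lattice_ball_def mem_Collect_eq n by (auto simp: transpose_def)
    show ?thesis
      by (rule sum.reindex_bij_witness[where i = ?T and j = ?T]) (use T in \<open>auto simp: fun_eq_iff\<close>)
  qed
  have "(\<Sum>w\<in>lattice_ball D k. normsq D w) = (\<Sum>j<D. \<Sum>w\<in>lattice_ball D k. (w j)\<^sup>2)"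
    unfolding normsq_def by (rule sum.swap)
  also have "\<dots> = (\<Sum>j<D. \<Sum>w\<in>lattice_ball D k. (w i)\<^sup>2)"
    by (intro sum.cong refl eq[symmetric]) simp
  finally show ?thesis by simp
qed

lemma second_moment_lattice_ball:
  "int D * (\<Sum>w\<in>lattice_ball D k. (\<Sum>i<D. c i * w i)\<^sup>2) =
    normsq D c * (\<Sum>w\<in>lattice_ball D k. normsq D w)"
proof -
  let ?W = "lattice_ball D k"
  have "(\<Sum>w\<in>?W. (\<Sum>i<D. c i * w i)\<^sup>2) = (\<Sum>w\<in>?W. \<Sum>i<D. \<Sum>j<D. (c i * c j) * (w i * w j))"
    by (simp add: power2_eq_square sum_product algebra_simps)
  also have "\<dots> = (\<Sum>i<D. \<Sum>w\<in>?W. \<Sum>j<D. (c i * c j) * (w i * w j))" by (rule sum.swap)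
  also have "\<dots> = (\<Sum>i<D. \<Sum>j<D. \<Sum>w\<in>?W. (c i * c j) * (w i * w j))"
    by (intro sum.cong refl sum.swap)
  also have "\<dots> = (\<Sum>i<D. \<Sum>j<D. (c i * c j) * (\<Sum>w\<in>?W. w i * w j))"
    by (simp add: sum_distrib_left)
  also have "\<dots> = (\<Sum>i<D. \<Sum>j<D. if i = j then (c i)\<^sup>2 * (\<Sum>w\<in>?W. (w i)\<^sup>2) else 0)"
    by (intro sum.cong refl) (auto simp: sum_mult_coords_lattice_ball power2_eq_square)
  also have "\<dots> = (\<Sum>i<D. (c i)\<^sup>2 * (\<Sum>w\<in>?W. (w i)\<^sup>2))" by simp
  finally have "int D * (\<Sum>w\<in>?W. (\<Sum>i<D. c i * w i)\<^sup>2) =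
      (\<Sum>i<D. (c i)\<^sup>2 * (int D * (\<Sum>w\<in>?W. (w i)\<^sup>2)))"
    by (simp add: sum_distrib_left algebra_simps)
  also have "\<dots> = (\<Sum>i<D. (c i)\<^sup>2 * (\<Sum>w\<in>?W. normsq D w))"
    by (intro sum.cong refl) (simp add: sum_square_coord_lattice_ball)
  finally show ?thesis by (simp add: normsq_def sum_distrib_right)
qed

text \<open>Chebyshev's inequality for a linear form on the ball.\<close>

lemma card_large_inner_lattice_ball:
  assumes "0 < t"
  shows "real D * (real (card {w \<in> lattice_ball D k. t < \<bar>real_of_int (\<Sum>i<D. c i * w i)\<bar>}) * t\<^sup>2)
    \<le> real_of_int (normsq D c) * (k * real (card (lattice_ball D k)))"
proof -
  let ?W = "lattice_ball D k" and ?p = "\<lambda>w. \<Sum>i<D. c i * w i"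
  let ?A = "{w \<in> ?W. t < \<bar>real_of_int (?p w)\<bar>}"
  have "real (card ?A) * t\<^sup>2 = (\<Sum>w\<in>?A. t\<^sup>2)" by simp
  also have "\<dots> \<le> (\<Sum>w\<in>?A. (real_of_int (?p w))\<^sup>2)"
    using assms by (intro sum_mono abs_le_square_iff[THEN iffD1]) auto
  also have "\<dots> \<le> (\<Sum>w\<in>?W. (real_of_int (?p w))\<^sup>2)" by (intro sum_mono2) auto
  also have "\<dots> = real_of_int (\<Sum>w\<in>?W. (?p w)\<^sup>2)" by simp
  finally have "real D * (real (card ?A) * t\<^sup>2) \<le> real D * real_of_int (\<Sum>w\<in>?W. (?p w)\<^sup>2)"
    by (rule mult_left_mono) simp
  also have "\<dots> = real_of_int (int D * (\<Sum>w\<in>?W. (?p w)\<^sup>2))" by simp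
  also have "\<dots> = real_of_int (normsq D c) * (\<Sum>w\<in>?W. real_of_int (normsq D w))"
    unfolding second_moment_lattice_ball by simp
  also have "\<dots> \<le> real_of_int (normsq D c) * (\<Sum>w\<in>?W. k)"
    by (intro mult_left_mono sum_mono) (auto simp: lattice_ball_def normsq_def sum_nonneg)
  finally show ?thesis by (simp add: mult.commute)
qed

text \<open>Rounding the coordinates of \<open>z / 2\<close> costs only a factor \<open>1 + 2 / sqrt D\<close> in the squared norm.\<close>

lemma normsq_half_le:
  assumes D: "1 \<le> D" and k: "(1 + sqrt (real D)) * real D * sqrt (real D) \<le> k"
    and z: "z \<in> lattice_ball D k" and c: "\<And>i. \<bar>2 * c i - z i\<bar> \<le> 1"
  shows "real_of_int (normsq D c) \<le> (1 + 2 / sqrt (real D)) * k / 4"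
proof -
  define q where "q = sqrt (real D)"
  have q: "0 < q" using D by (simp add: q_def)
  have term_le: "4 * (real_of_int (c i))\<^sup>2 \<le> (1 + 1 / q) * (real_of_int (z i))\<^sup>2 + (1 + q)" for i
  proof -
    have "\<bar>2 * real_of_int (c i) - real_of_int (z i)\<bar> \<le> 1"
      using c[of i] by linarith
    then have "\<bar>2 * real_of_int (c i)\<bar> \<le> \<bar>real_of_int (z i)\<bar> + 1" by linarith
    then have "(2 * real_of_int (c i))\<^sup>2 \<le> (\<bar>real_of_int (z i)\<bar> + 1)\<^sup>2"
      by (metis abs_ge_zero abs_le_square_iff abs_of_nonneg add_nonneg_nonneg zero_le_one)
    also have "\<dots> = (real_of_int (z i))\<^sup>2 + 2 * \<bar>real_of_int (z i)\<bar> + 1"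
      by (simp add: power2_sum)
    also have "2 * \<bar>real_of_int (z i)\<bar> \<le> (real_of_int (z i))\<^sup>2 / q + q"
    proof -
      have "0 \<le> (\<bar>real_of_int (z i)\<bar> - q)\<^sup>2 / q" using q by simp
      also have "\<dots> = (real_of_int (z i))\<^sup>2 / q + q - 2 * \<bar>real_of_int (z i)\<bar>"
        using q by (simp add: power2_diff field_simps power2_eq_square)
      finally show ?thesis by simp
    qed
    finally show ?thesis by (simp add: power_mult_distrib algebra_simps)
  qed
  have "4 * real_of_int (normsq D c) = (\<Sum>i<D. 4 * (real_of_int (c i))\<^sup>2)"
    by (simp add: normsq_def sum_distrib_left)
  also have "\<dots> \<le> (\<Sum>i<D. (1 + 1 / q) * (real_of_int (z i))\<^sup>2 + (1 + q))"
    by (intro sum_mono term_le)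
  also have "\<dots> = (1 + 1 / q) * real_of_int (normsq D z) + real D * (1 + q)"
    by (simp add: normsq_def sum.distrib sum_distrib_left)
  also have "\<dots> \<le> (1 + 1 / q) * k + k / q"
  proof (intro add_mono mult_left_mono)
    show "real_of_int (normsq D z) \<le> k" using z by (simp add: lattice_ball_def)
    show "real D * (1 + q) \<le> k / q" using k q by (simp add: q_def field_simps)
  qed (use q in simp)
  also have "\<dots> = (1 + 2 / q) * k" using q by (simp add: field_simps)
  finally show ?thesis by (simp add: q_def)
qed

text \<open>Every point \<open>z\<close> of the ball has many representations as a sum of two points of the ball. The
  vectors \<open>z/2 + w\<close> and \<open>z/2 - w\<close> have squared norm at most
  \<open>k/4 + normsq D w + \<bar>\<langle>z, w\<rangle>\<bar>\<close>, and for most \<open>w\<close> in a ball the inner product is of smaller order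
  than \<open>k\<close>. So at least half of the \<open>w\<close> of squared norm at most \<open>(3/4 - o(1)) * k\<close> give a representation, once
  \<open>z/2\<close> is rounded to the integer vectors \<open>c\<close> and \<open>c'\<close> with \<open>c + c' = z\<close>.\<close>

lemma card_representations_lattice_ball:
  assumes D: "256 \<le> D" and k: "(1 + sqrt (real D)) * real D * sqrt (real D) \<le> k"
    and z: "z \<in> lattice_ball D k"
  shows "real (card (lattice_ball D ((3/4 - 3 / sqrt (real D)) * k))) / 2 \<le>
    real (card {x \<in> lattice_ball D k. (\<lambda>i. z i - x i) \<in> lattice_ball D k})"
proof -
  define q where "q = sqrt (real D)"
  have q: "16 \<le> q" "q\<^sup>2 = real D"
  proof -
    have "sqrt 256 \<le> q" unfolding q_def using D by (intro real_sqrt_le_mono) simp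
    then show "16 \<le> q" by simp
  qed (simp add: q_def)
  have "0 < (1 + q) * real D * q" using D q by simp
  then have k0: "0 < k" using k by (simp add: q_def)
  define W where "W = lattice_ball D ((3/4 - 3 / q) * k)"
  define c where "c = (\<lambda>i. z i div 2)"
  define c' where "c' = (\<lambda>i. z i - z i div 2)"
  have half: "real_of_int (normsq D c) \<le> (1 + 2 / q) * k / 4"
    "real_of_int (normsq D c') \<le> (1 + 2 / q) * k / 4"
  proof -
    have "\<bar>2 * c i - z i\<bar> \<le> 1" "\<bar>2 * c' i - z i\<bar> \<le> 1" for i
      unfolding c_def c'_def by presburger+
    then show "real_of_int (normsq D c) \<le> (1 + 2 / q) * k / 4"
      "real_of_int (normsq D c') \<le> (1 + 2 / q) * k / 4"
      unfolding q_def using normsq_half_le[OF _ k z] D by auto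
  qed
  define bad where "bad = (\<lambda>a. {w \<in> W. k / q < \<bar>real_of_int (\<Sum>i<D. a i * w i)\<bar>})"
  have bad: "real (card (bad a)) \<le> real (card W) / 4"
    if a: "real_of_int (normsq D a) \<le> (1 + 2 / q) * k / 4" for a
  proof -
    have t: "0 < k / q" using k0 q by simp
    have "real (card (bad a)) * k\<^sup>2 = real D * (real (card (bad a)) * (k / q)\<^sup>2)"
      using q D by (simp add: power_divide)
    also have "\<dots> \<le> real_of_int (normsq D a) * ((3/4 - 3 / q) * k * real (card W))"
      unfolding bad_def W_def by (rule card_large_inner_lattice_ball[OF t])
    also have "\<dots> \<le> (k / 3) * (3/4 * k * real (card W))"
    proof (rule mult_mono)
      have "(1 + 2 / q) * k / 4 \<le> (1 + 2 / 16) * k / 4"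
        using q k0 by (intro divide_right_mono mult_right_mono add_left_mono divide_left_mono) auto
      also have "\<dots> \<le> k / 3" using k0 by simp
      finally show "real_of_int (normsq D a) \<le> k / 3" using a by linarith
      show "(3/4 - 3 / q) * k * real (card W) \<le> 3/4 * k * real (card W)"
        using q k0 by (intro mult_right_mono) auto
      have "3 / q \<le> 3 / 16" using q by (intro divide_left_mono) auto
      then show "0 \<le> (3/4 - 3 / q) * k * real (card W)" using k0 by (intro mult_nonneg_nonneg) auto
    qed (use k0 in auto)
    also have "\<dots> = real (card W) / 4 * k\<^sup>2" by (simp add: power2_eq_square)
    finally show ?thesis using k0 by simp
  qed
  define G where "G = W - bad c - bad c'"
  have W: "finite W" "bad c \<subseteq> W" "bad c' \<subseteq> W" by (auto simp: W_def bad_def)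
  have "card W \<le> card G + (card (bad c) + card (bad c'))"
  proof -
    have "W = G \<union> (bad c \<union> bad c')" using W by (auto simp: G_def)
    then have "card W \<le> card G + card (bad c \<union> bad c')" by (metis card_Un_le)
    then show ?thesis using card_Un_le[of "bad c" "bad c'"] by linarith
  qed
  then have "real (card W) \<le> real (card G) + (real (card (bad c)) + real (card (bad c')))"
    by (metis of_nat_add of_nat_le_iff)
  then have G: "real (card W) / 2 \<le> real (card G)"
    using bad[OF half(1)] bad[OF half(2)] by linarith
  let ?f = "\<lambda>w i. c i + w i"
  have "card G \<le> card {x \<in> lattice_ball D k. (\<lambda>i. z i - x i) \<in> lattice_ball D k}"
  proof (rule card_inj_on_le[of ?f])
    show "inj_on ?f G" by (auto simp: inj_on_def fun_eq_iff)
    show "?f ` G \<subseteq> {x \<in> lattice_ball D k. (\<lambda>i. z i - x i) \<in> lattice_ball D k}"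
    proof (intro image_subsetI CollectI conjI)
      fix w assume w: "w \<in> G"
      have wW: "w \<in> W" and ip: "\<bar>real_of_int (\<Sum>i<D. c i * w i)\<bar> \<le> k / q" "\<bar>real_of_int (\<Sum>i<D. c' i * w i)\<bar> \<le> k / q"
        using w by (auto simp: G_def bad_def)
      have nw: "real_of_int (normsq D w) \<le> (3/4 - 3 / q) * k"
        using wW by (simp add: W_def lattice_ball_def)
      \<comment> \<open>of the margin \<open>3 / q\<close>, rounding uses \<open>1 / (2 * q)\<close> and the inner product \<open>2 / q\<close>\<close>
      have total: "(1 + 2 / q) * k / 4 + (3/4 - 3 / q) * k + 2 * (k / q) \<le> k"
        using k0 q by (simp add: field_simps)
      have z0: "z i = 0" and w0: "w i = 0" if "D \<le> i" for i
        using z wW that by (auto simp: lattice_ball_def W_def)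
      have "real_of_int (normsq D (?f w)) \<le> k"
        unfolding normsq_add of_int_add of_int_mult of_int_numeral
        using half(1) nw abs_le_D1[OF ip(1)] total by linarith
      then show "?f w \<in> lattice_ball D k" using z0 w0 by (simp add: lattice_ball_def c_def)
      have eq: "(\<lambda>i. z i - ?f w i) = (\<lambda>i. c' i - w i)" by (simp add: c_def c'_def fun_eq_iff)
      have "real_of_int (normsq D (\<lambda>i. c' i - w i)) \<le> k"
        unfolding normsq_diff of_int_add of_int_diff of_int_mult of_int_numeral
        using half(2) nw abs_le_D2[OF ip(2)] total by linarith
      then show "(\<lambda>i. z i - ?f w i) \<in> lattice_ball D k"
        unfolding eq using z0 w0 by (simp add: lattice_ball_def c'_def)
    qed
  qed simp
  then show ?thesis using G unfolding W_def q_def by linarith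
qed

text \<open>Shrinking the squared radius by \<open>l\<close> should multiply the number of points by
  about \<open>sqrt l ^ D\<close>. If it fell further, by the extra factor stated below, at each of the \<open>m\<close> scales \<open>K / l ^ j\<close>, the accumulated loss
  would contradict the crude bounds on the number of points at the two extreme scales. This
  yields one good scale without an asymptotic formula for the number of lattice points.\<close>

lemma lattice_ball_good_scale:
  assumes D: "1 \<le> D" and m: "1 \<le> m" and lam: "0 < l" "l \<le> 1" and K: "1 \<le> K"
  shows "\<exists>k. K \<le> k \<and> k \<le> K / l ^ m \<and>
    sqrt l ^ D * (3 * sqrt (real D)) powr (- (real D / real m)) * real (card (lattice_ball D k))
      \<le> real (card (lattice_ball D (l * k)))"
proof (rule ccontr)
  assume neg: "\<not> ?thesis"
  define q where "q = 3 * sqrt (real D)"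
  have q: "0 < q" using D by (simp add: q_def)
  define \<kappa> where "\<kappa> = sqrt l ^ D * q powr (- (real D / real m))"
  have \<kappa>: "0 < \<kappa>" using lam q by (simp add: \<kappa>_def)
  define g where "g = (\<lambda>j. real (card (lattice_ball D (K / l ^ j))))"
  have step: "g j < \<kappa> * g (Suc j)" if "j < m" for j
  proof -
    have "K * 1 \<le> K * (1 / l ^ Suc j)"
      using K lam power_le_one[of l "Suc j"] by (intro mult_left_mono) (auto simp: field_simps)
    then have 1: "K \<le> K / l ^ Suc j" by simp
    have "l ^ m \<le> l ^ Suc j" using lam that by (intro power_decreasing) auto
    then have 2: "K / l ^ Suc j \<le> K / l ^ m" using lam K by (intro divide_left_mono) auto
    have 3: "l * (K / l ^ Suc j) = K / l ^ j" using lam by simp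
    show ?thesis
      using neg[unfolded not_ex, rule_format, of "K / l ^ Suc j"] 1 2
      unfolding 3 g_def \<kappa>_def q_def by (simp only: simp_thms not_le)
  qed
  have iter: "g 0 \<le> \<kappa> ^ j * g j" if "j \<le> m" for j
    using that
  proof (induction j)
    case (Suc j)
    then have "g 0 \<le> \<kappa> ^ j * g j" by simp
    also have "\<dots> \<le> \<kappa> ^ j * (\<kappa> * g (Suc j))"
      using step[of j] Suc.prems \<kappa> by (intro mult_left_mono) auto
    finally show ?case by (simp add: mult_ac)
  qed simp
  have strict: "g 0 < \<kappa> ^ m * g m"
  proof -
    obtain j where j: "m = Suc j" using m by (cases m) auto
    have "g 0 \<le> \<kappa> ^ j * g j" using iter j by simp
    also have "\<dots> < \<kappa> ^ j * (\<kappa> * g (Suc j))" using step[of j] \<kappa> j by simp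
    finally show ?thesis by (simp add: j mult_ac)
  qed
  have \<kappa>m: "\<kappa> ^ m = (sqrt l ^ m / q) ^ D"
  proof -
    have "(q powr (- (real D / real m))) ^ m = q powr (- real D)"
      using q m by (simp add: powr_powr flip: powr_realpow)
    also have "\<dots> = (1 / q) ^ D"
      using q by (simp add: powr_minus powr_realpow divide_simps power_one_over)
    finally show ?thesis
      by (simp add: \<kappa>_def power_mult_distrib power_divide mult.commute flip: power_mult)
  qed
  have pos: "0 < l ^ m" using lam by simp
  have "1 \<le> K / l ^ m" using K lam pos power_le_one[of l m] by (simp add: field_simps)
  then have "g m \<le> (3 * sqrt (K / l ^ m)) ^ D"
    unfolding g_def by (rule card_lattice_ball_le)
  then have "\<kappa> ^ m * g m \<le> (sqrt l ^ m / q) ^ D * (3 * sqrt (K / l ^ m)) ^ D"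
    unfolding \<kappa>m using q lam by (intro mult_left_mono) auto
  also have "\<dots> = (sqrt l ^ m / q * (3 * sqrt (K / l ^ m))) ^ D" by (rule power_mult_distrib[symmetric])
  also have "sqrt l ^ m / q * (3 * sqrt (K / l ^ m)) = sqrt (K / real D)"
    using lam D by (simp add: q_def real_sqrt_divide real_sqrt_power)
  also have "sqrt (K / real D) ^ D \<le> g 0"
    using card_lattice_ball_ge[of K D] K by (simp add: g_def)
  finally show False using strict by simp
qed

section \<open>Triples of lattice points and the removal constant\<close>

text \<open>The triples \<open>(x, y, x + y)\<close> in the ball, and the subfamily on which \<open>x - y\<close> has squared norm
  \<open>r\<close>.\<close>

definition sum_triples :: "nat \<Rightarrow> real \<Rightarrow> ((nat \<Rightarrow> int) \<times> (nat \<Rightarrow> int) \<times> (nat \<Rightarrow> int)) set" where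
  "sum_triples D k = {(x, y, z). x \<in> lattice_ball D k \<and> y \<in> lattice_ball D k \<and> z \<in> lattice_ball D k \<and>
    z = (\<lambda>i. x i + y i)}"

definition sum_triples_at :: "nat \<Rightarrow> real \<Rightarrow> int \<Rightarrow> ((nat \<Rightarrow> int) \<times> (nat \<Rightarrow> int) \<times> (nat \<Rightarrow> int)) set" where
  "sum_triples_at D k r = {(x, y, z) \<in> sum_triples D k. normsq D (\<lambda>i. x i - y i) = r}"

lemma finite_sum_triples [simp]: "finite (sum_triples D k)"
  by (rule finite_subset[of _ "lattice_ball D k \<times> lattice_ball D k \<times> lattice_ball D k"])
    (auto simp: sum_triples_def)

lemma card_sum_triples:
  "card (sum_triples D k) =
    (\<Sum>z\<in>lattice_ball D k. card {x \<in> lattice_ball D k. (\<lambda>i. z i - x i) \<in> lattice_ball D k})"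
proof -
  let ?B = "lattice_ball D k"
  let ?P = "SIGMA z : ?B. {x \<in> ?B. (\<lambda>i. z i - x i) \<in> ?B}"
  have "bij_betw (\<lambda>(x, y, z). (z, x)) (sum_triples D k) ?P"
    by (rule bij_betw_byWitness[where f' = "\<lambda>(z, x). (x, \<lambda>i. z i - x i, z)"])
      (auto simp: sum_triples_def)
  then have "card (sum_triples D k) = card ?P" by (rule bij_betw_same_card)
  then show ?thesis by simp
qed

lemma card_sum_triples_at_le: "card (sum_triples_at D k r) \<le> card (lattice_ball D k) ^ 2"
proof -
  have "card (sum_triples_at D k r) \<le> card (lattice_ball D k \<times> lattice_ball D k)"
    by (rule card_inj_on_le[of "\<lambda>(x, y, z). (x, y)"])
      (auto simp: inj_on_def sum_triples_at_def sum_triples_def)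
  then show ?thesis by (simp add: card_cartesian_product power2_eq_square)
qed

lemma sum_triples_at_pigeonhole:
  assumes "0 \<le> k"
  shows "\<exists>r. real (card (sum_triples D k)) / (4 * k + 1) \<le> real (card (sum_triples_at D k r))"
proof (rule ccontr)
  let ?P = "sum_triples D k" and ?S = "sum_triples_at D k" and ?R = "{0..\<lfloor>4 * k\<rfloor>}"
  assume "\<not> ?thesis"
  then have lt: "real (card (?S r)) < real (card ?P) / (4 * k + 1)" for r by (simp add: not_le)
  have "?P = (\<Union>r\<in>?R. ?S r)"
  proof
    show "?P \<subseteq> (\<Union>r\<in>?R. ?S r)"
    proof
      fix p assume "p \<in> ?P"
      then obtain x y z where p: "p = (x, y, z)" "(x, y, z) \<in> ?P" by (cases p) auto
      have "real_of_int (normsq D x) \<le> k" "real_of_int (normsq D y) \<le> k"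
        using p(2) by (auto simp: sum_triples_def lattice_ball_def)
      moreover have "real_of_int (normsq D (\<lambda>i. x i - y i)) \<le> real_of_int (2 * normsq D x + 2 * normsq D y)"
        using parallelogram_normsq[of D x y] normsq_nonneg[of D "\<lambda>i. x i + y i"] by linarith
      ultimately have "normsq D (\<lambda>i. x i - y i) \<in> ?R"
        using normsq_nonneg by (auto simp: le_floor_iff)
      then show "p \<in> (\<Union>r\<in>?R. ?S r)" using p by (auto simp: sum_triples_at_def)
    qed
  qed (auto simp: sum_triples_at_def)
  then have "card ?P \<le> (\<Sum>r\<in>?R. card (?S r))"
    using card_UN_le[of ?R ?S] by simp
  then have "real (card ?P) \<le> (\<Sum>r\<in>?R. real (card (?S r)))"
    by (metis of_nat_le_iff of_nat_sum)
  also have "\<dots> < (\<Sum>r\<in>?R. real (card ?P) / (4 * k + 1))"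
    using lt assms by (intro sum_strict_mono) auto
  also have "\<dots> = real_of_int (\<lfloor>4 * k\<rfloor> + 1) * (real (card ?P) / (4 * k + 1))"
    using assms by simp
  also have "\<dots> \<le> (4 * k + 1) * (real (card ?P) / (4 * k + 1))"
    using assms by (intro mult_right_mono) auto
  also have "\<dots> = real (card ?P)" using assms by simp
  finally show False by simp
qed

text \<open>If \<open>(x, y)\<close>, \<open>(y, z)\<close> and \<open>(x, z)\<close> all occur in triples of \<open>sum_triples_at D k r\<close>, put
  \<open>v = x - y\<close> and \<open>u = x + y - z\<close>. The three conditions on the norm say that \<open>v\<close>, \<open>v - u\<close> and \<open>v + u\<close>
  have equal norm, which by the parallelogram law forces \<open>u = 0\<close>.\<close>

lemma sum_triples_at_uniq:
  assumes "(x, y, z') \<in> sum_triples_at D k r" "(x', y, z) \<in> sum_triples_at D k r"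
    "(x, y', z) \<in> sum_triples_at D k r"
  shows "x' = x \<and> y' = y \<and> z' = z"
proof -
  have eqs: "z' = (\<lambda>i. x i + y i)" "z = (\<lambda>i. x' i + y i)" "z = (\<lambda>i. x i + y' i)"
    and supp: "\<forall>i\<ge>D. x i = 0 \<and> y i = 0 \<and> z i = 0"
    and r: "normsq D (\<lambda>i. x i - y i) = r" "normsq D (\<lambda>i. x' i - y i) = r" "normsq D (\<lambda>i. x i - y' i) = r"
    using assms by (auto simp: sum_triples_at_def sum_triples_def lattice_ball_def)
  have x': "x' = (\<lambda>i. z i - y i)" using eqs(2) by (auto simp: fun_eq_iff)
  have y': "y' = (\<lambda>i. z i - x i)" using eqs(3) by (auto simp: fun_eq_iff)
  define u where "u = (\<lambda>i. x i + y i - z i)"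
  define v where "v = (\<lambda>i. x i - y i)"
  have "(\<lambda>i. x' i - y i) = (\<lambda>i. v i - u i)" "(\<lambda>i. x i - y' i) = (\<lambda>i. v i + u i)"
    by (simp_all add: u_def v_def x' y' fun_eq_iff)
  then have "normsq D u = 0"
    using parallelogram_normsq[of D v u] r by (simp add: v_def)
  then have "u i = 0" if "i < D" for i
    using that unfolding normsq_def by (subst (asm) sum_nonneg_eq_0_iff) auto
  moreover have "u i = 0" if "\<not> i < D" for i using supp that by (simp add: u_def)
  ultimately have "x i + y i = z i" for i unfolding u_def by (metis eq_iff_diff_eq_0)
  then show ?thesis unfolding x' y' eqs(1) by (auto simp: fun_eq_iff algebra_simps)
qed

text \<open>The graph built from \<open>sum_triples_at D k r\<close>, for a good scale \<open>k\<close> and a popular value \<open>r\<close>, has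
  \<open>3 * N\<close> vertices and at most \<open>N^2\<close> triangles, where \<open>N\<close> is the number of points of the ball.\<close>

lemma removal_property_upper_bound:
  assumes D: "256 \<le> D" and m: "1 \<le> m" and K: "(1 + sqrt (real D)) * real D * sqrt (real D) \<le> K"
    and l: "l = 3/4 - 3 / sqrt (real D)"
    and rem: "removal_property \<epsilon> \<delta>"
    and eps: "\<epsilon> \<le> sqrt l ^ D * (3 * sqrt (real D)) powr (- (real D / real m)) / (18 * (4 * (K / l ^ m) + 1))"
  shows "\<delta> \<le> 1 / sqrt (K / real D) ^ D"
proof -
  define \<kappa> where "\<kappa> = sqrt l ^ D * (3 * sqrt (real D)) powr (- (real D / real m))"
  have s: "16 \<le> sqrt (real D)"
  proof -
    have "sqrt 256 \<le> sqrt (real D)" using D by (intro real_sqrt_le_mono) simp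
    then show ?thesis by simp
  qed
  have "3 / sqrt (real D) \<le> 3 / 16" using s D by (intro divide_left_mono) auto
  then have "1/2 \<le> l" by (simp add: l)
  moreover have "l \<le> 1" unfolding l using zero_le_divide_iff[of 3 "sqrt (real D)"] s by linarith
  ultimately have lb: "0 < l" "l \<le> 1" by auto
  have \<kappa>: "0 < \<kappa>" using lb D by (simp add: \<kappa>_def)
  have "1 * 1 * 1 \<le> (1 + sqrt (real D)) * real D * sqrt (real D)"
    using D s by (intro mult_mono) auto
  then have K1: "1 \<le> K" using K by simp
  obtain k where k: "K \<le> k" "k \<le> K / l ^ m"
    and scale: "\<kappa> * real (card (lattice_ball D k)) \<le> real (card (lattice_ball D (l * k)))"
    using lattice_ball_good_scale[OF _ m lb K1, of D] D unfolding \<kappa>_def by auto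
  define N where "N = real (card (lattice_ball D k))"
  have N_ge: "sqrt (K / real D) ^ D \<le> N"
  proof -
    have "sqrt (K / real D) ^ D \<le> sqrt (k / real D) ^ D"
      using k K1 by (intro power_mono real_sqrt_le_mono divide_right_mono) auto
    also have "\<dots> \<le> N" unfolding N_def using k K1 by (intro card_lattice_ball_ge) auto
    finally show ?thesis .
  qed
  have pos: "0 < sqrt (K / real D) ^ D" using K1 D by simp
  have N: "0 < N" using pos N_ge by linarith
  have "\<kappa> * N / 2 * N = (\<Sum>z\<in>lattice_ball D k. \<kappa> * N / 2)" by (simp add: N_def)
  also have "\<dots> \<le> (\<Sum>z\<in>lattice_ball D k. real (card {x \<in> lattice_ball D k. (\<lambda>i. z i - x i) \<in> lattice_ball D k}))"
  proof (intro sum_mono)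
    fix z assume "z \<in> lattice_ball D k"
    then have "real (card (lattice_ball D (l * k))) / 2
        \<le> real (card {x \<in> lattice_ball D k. (\<lambda>i. z i - x i) \<in> lattice_ball D k})"
      unfolding l using D K k by (intro card_representations_lattice_ball) auto
    then show "\<kappa> * N / 2 \<le> real (card {x \<in> lattice_ball D k. (\<lambda>i. z i - x i) \<in> lattice_ball D k})"
      using scale unfolding N_def by linarith
  qed
  also have "\<dots> = real (card (sum_triples D k))" by (simp add: card_sum_triples)
  finally have total: "\<kappa> / 2 * N^2 \<le> real (card (sum_triples D k))" by (simp add: power2_eq_square mult_ac)
  obtain r where r: "real (card (sum_triples D k)) / (4 * k + 1) \<le> real (card (sum_triples_at D k r))"
    using sum_triples_at_pigeonhole[of k D] k K1 by auto
  let ?S = "sum_triples_at D k r"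
  have "\<epsilon> * (3 * N)^2 \<le> \<kappa> / (18 * (4 * k + 1)) * (3 * N)^2"
  proof (rule mult_right_mono)
    have "\<kappa> / (18 * (4 * (K / l ^ m) + 1)) \<le> \<kappa> / (18 * (4 * k + 1))"
      using k K1 \<kappa> lb by (intro divide_left_mono) (auto simp: add_pos_nonneg)
    then show "\<epsilon> \<le> \<kappa> / (18 * (4 * k + 1))" using eps by (simp add: \<kappa>_def)
  qed simp
  also have "\<dots> = \<kappa> / 2 * N^2 / (4 * k + 1)" using k K1 by (simp add: field_simps)
  also have "\<dots> \<le> real (card ?S)"
    using r divide_right_mono[OF total, of "4 * k + 1"] k K1 by linarith
  finally have large: "\<epsilon> * (3 * N)^2 \<le> real (card ?S)" .
  have "\<delta> * (3 * N)^3 \<le> real (card ?S)"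
    unfolding N_def
  proof (rule removal_bound_of_triples[OF _ _ _ sum_triples_at_uniq rem])
    show "lattice_ball D k \<noteq> {}" using N unfolding N_def by auto
    show "?S \<subseteq> lattice_ball D k \<times> lattice_ball D k \<times> lattice_ball D k"
      by (auto simp: sum_triples_at_def sum_triples_def)
  qed (use large N_def in auto)
  also have "real (card ?S) \<le> N^2"
    using card_sum_triples_at_le[of D k r] unfolding N_def by (metis of_nat_le_iff of_nat_power)
  finally have "\<delta> * (27 * N) * N^2 \<le> 1 * N^2" by (simp add: power2_eq_square power3_eq_cube mult_ac)
  then have 1: "\<delta> * (27 * N) \<le> 1" using N by (simp only: mult_le_cancel_right) auto
  show ?thesis
  proof (cases "\<delta> \<le> 0")
    case True
    then show ?thesis using pos by (meson order_trans zero_le_divide_1_iff less_imp_le)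
  next
    case False
    then have "\<delta> * sqrt (K / real D) ^ D \<le> \<delta> * (27 * N)"
      using N_ge N by (intro mult_left_mono) auto
    then show ?thesis using 1 pos by (simp add: pos_le_divide_eq)
  qed
qed

section \<open>Asymptotics\<close>

lemma ln_density_bound: "eventually (\<lambda>x::real. x powr (3/4) * ln (3/4) \<le>
   x / 2 * ln (1 - 4 / sqrt x) - sqrt x * ln (3 * sqrt x) - ln (90 * x) - (sqrt x + 1) * ln 2) at_top"
  by real_asymp

text \<open>The right-hand side is a lower bound for the number of triples divided by \<open>9 * N^2\<close>, in dimension
  \<open>x\<close> with \<open>K = x * (4/3) powr (x/2)\<close> and \<open>m\<close> about \<open>sqrt x\<close>. The factor \<open>(3/4) powr (x/2)\<close> from
  the shrinking of the ball and the division by \<open>(4/3) powr (x/2)\<close>, for the number of values of \<open>r\<close>,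
  combine to \<open>(3/4) powr x\<close>; the remaining factors are \<open>exp (- O (sqrt x * ln x))\<close>.\<close>

lemma density_bound: "eventually (\<lambda>x::real. (3/4) powr (x + x powr (3/4)) \<le>
   (3/4 - 3 / sqrt x) powr (x/2) * (3 * sqrt x) powr (- sqrt x) / (18 * (4 * (x * (4/3) powr (x/2) * 2 powr (sqrt x + 1)) + 1))) at_top"
  using ln_density_bound eventually_gt_at_top[of 16]
proof eventually_elim
  case (elim x)
  define s where "s = sqrt x"
  have s: "4 < s" using elim(2) real_sqrt_less_mono[of 16 x] by (simp add: s_def)
  define A where "A = x * (4/3) powr (x/2) * 2 powr (s + 1)"
  have "1 * 1 * 1 \<le> A" unfolding A_def using elim(2) s by (intro mult_mono ge_one_powr_ge_zero) auto
  then have A: "1 \<le> A" by simp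
  have lnA: "ln (90 * A) = ln (90 * x) - x / 2 * ln (3/4) + (s + 1) * ln 2"
    using elim(2) by (simp add: A_def ln_mult ln_powr ln_div algebra_simps)
  define b where "b = 1 - 4 / s"
  have b: "3/4 - 3 / s = 3/4 * b" "0 < b" using s by (simp_all add: b_def field_simps)
  define R where "R = (3/4 * b) powr (x/2) * (3 * s) powr (- s) / (90 * A)"
  have R0: "0 < R" using b s A by (simp add: R_def)
  have "ln R = x / 2 * ln (3/4 * b) - s * ln (3 * s) - ln (90 * A)"
    using b(2) s A unfolding R_def by (subst ln_div, simp_all add: ln_mult ln_powr)
  also have "ln (3/4 * b) = ln (3/4) + ln b" using b(2) by (intro ln_mult_pos) auto
  finally have R: "0 < R" "ln R = x / 2 * (ln (3/4) + ln b) - s * ln (3 * s) - ln (90 * A)"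
    using R0 by auto
  have "(x + x powr (3/4)) * ln (3/4) \<le> ln R"
    using elim(1) unfolding R(2) lnA b_def s_def by (simp add: algebra_simps)
  then have "exp ((x + x powr (3/4)) * ln (3/4)) \<le> exp (ln R)" by (simp only: exp_le_cancel_iff)
  then have "(3/4) powr (x + x powr (3/4)) \<le> R" using R(1) by (simp add: powr_def)
  also have "R \<le> (3/4 - 3 / s) powr (x/2) * (3 * s) powr (- s) / (18 * (4 * A + 1))"
    unfolding R_def b(1) using A s b(2) by (intro divide_left_mono) auto
  finally show ?case by (simp only: s_def A_def)
qed

lemma dimension_tendsto:
  assumes "a > 0"
  shows "((\<lambda>x::real. real (nat \<lfloor>x / a - x powr (7/8)\<rfloor>) / x) \<longlongrightarrow> inverse a) at_top"
proof (rule tendsto_sandwich)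
  show "((\<lambda>x. (x / a - x powr (7/8) - 1) / x) \<longlongrightarrow> inverse a) at_top" using assms by real_asymp
  show "((\<lambda>x. inverse a) \<longlongrightarrow> inverse a) at_top" by simp
  have pos: "eventually (\<lambda>x. 0 \<le> x / a - x powr (7/8)) at_top" using assms by real_asymp
  show "\<forall>\<^sub>F x in at_top. (x / a - x powr (7/8) - 1) / x \<le> real (nat \<lfloor>x / a - x powr (7/8)\<rfloor>) / x"
    using pos eventually_gt_at_top[of 0]
  proof eventually_elim
    case (elim x)
    show ?case using elim by (intro divide_right_mono) linarith+
  qed
  show "\<forall>\<^sub>F x in at_top. real (nat \<lfloor>x / a - x powr (7/8)\<rfloor>) / x \<le> inverse a"
    using pos eventually_gt_at_top[of 0]
  proof eventually_elim
    case (elim x)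
    have "real (nat \<lfloor>x / a - x powr (7/8)\<rfloor>) \<le> x / a - x powr (7/8)" using elim by linarith
    also have "\<dots> \<le> x / a" by simp
    finally have "real (nat \<lfloor>x / a - x powr (7/8)\<rfloor>) / x \<le> x / a / x" using elim by (intro divide_right_mono) auto
    then show ?case using elim by (simp add: field_simps)
  qed
qed

lemma dimension_filterlim:
  assumes "a > 0"
  shows "filterlim (\<lambda>x::real. nat \<lfloor>x / a - x powr (7/8)\<rfloor>) sequentially at_top"
proof -
  have "filterlim (\<lambda>x::real. x / a - x powr (7/8)) at_top at_top" using assms by real_asymp
  then show ?thesis
    by (intro filterlim_compose[OF filterlim_nat_sequentially] filterlim_compose[OF filterlim_floor_sequentially])
qed

lemma removal_const_le_eventually:
  "\<forall>\<^sub>F D in sequentially. \<forall>\<epsilon>\<le>1/9. \<epsilon> \<le> (3/4) powr (real D + real D powr (3/4)) \<longrightarrow>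
    removal_const \<epsilon> \<le> (3/4) powr ((real D)\<^sup>2 / 4)"
proof -
  have ev: "\<forall>\<^sub>F x::real in at_top. (1 + sqrt x) * x * sqrt x \<le> x * (4/3) powr (x/2)"
    by real_asymp
  show ?thesis
    using eventually_compose_filterlim[OF ev filterlim_real_sequentially]
      eventually_compose_filterlim[OF density_bound filterlim_real_sequentially] eventually_ge_at_top[of 256]
  proof (eventually_elim, intro allI impI)
    fix D :: nat and \<epsilon> :: real
    define q where "q = sqrt (real D)"
    define l where "l = 3/4 - 3 / q"
    \<comment> \<open>\<open>K\<close> is such that restricting to one of the about \<open>4 * K\<close> values of \<open>r\<close> costs, to leading order,
      the same factor \<open>(3/4) powr (D/2)\<close> as requiring \<open>x + y\<close> to lie in the ball\<close>
    define K where "K = real D * (4/3) powr (real D / 2)"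
    define m where "m = nat \<lceil>q\<rceil>"
    assume K: "(1 + sqrt (real D)) * real D * sqrt (real D) \<le> real D * (4/3) powr (real D / 2)"
      and bound: "(3/4) powr (real D + real D powr (3/4)) \<le> (3/4 - 3 / sqrt (real D)) powr (real D / 2) *
        (3 * sqrt (real D)) powr - sqrt (real D) /
        (18 * (4 * (real D * (4/3) powr (real D / 2) * 2 powr (sqrt (real D) + 1)) + 1))"
      and D: "256 \<le> D" and \<epsilon>: "\<epsilon> \<le> 1/9" "\<epsilon> \<le> (3/4) powr (real D + real D powr (3/4))"
    have q: "16 \<le> q"
    proof -
      have "sqrt 256 \<le> q" unfolding q_def using D by (intro real_sqrt_le_mono) simp
      then show ?thesis by simp
    qed
    have qD: "q * q = real D" by (simp add: q_def)
    have m: "1 \<le> m" "q \<le> real m" "real m \<le> q + 1" using q unfolding m_def by linarith+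
    have "3 / q \<le> 3 / 16" using q by (intro divide_left_mono) auto
    then have l: "1/2 \<le> l" by (simp add: l_def)
    have K0: "0 \<le> K" by (simp add: K_def)
    have "K / l ^ m \<le> K * 2 powr (q + 1)"
    proof -
      have "(1/2) ^ m \<le> l ^ m" using l by (intro power_mono) auto
      then have "K / l ^ m \<le> K / (1/2) ^ m" using K0 l by (intro divide_left_mono) auto
      also have "\<dots> = K * 2 powr real m" by (simp add: powr_realpow power_one_over)
      also have "\<dots> \<le> K * 2 powr (q + 1)" using m K0 by (intro mult_left_mono) auto
      finally show ?thesis .
    qed
    moreover have "(3 * q) powr (- q) \<le> (3 * q) powr (- (real D / real m))"
    proof (rule powr_mono)
      have "real D \<le> q * real m" unfolding qD[symmetric] using m q by (intro mult_left_mono) auto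
      then show "- q \<le> - (real D / real m)" using m by (simp add: pos_divide_le_eq)
    qed (use q in simp)
    moreover have "l powr (real D / 2) = sqrt l ^ D"
      using l by (simp add: powr_half_sqrt powr_powr flip: powr_realpow powr_half_sqrt)
    moreover have "0 \<le> K / l ^ m" using K0 l by simp
    ultimately have "l powr (real D / 2) * (3 * q) powr (- q) / (18 * (4 * (K * 2 powr (q + 1)) + 1))
        \<le> sqrt l ^ D * (3 * q) powr (- (real D / real m)) / (18 * (4 * (K / l ^ m) + 1))"
      using l by (intro frac_le mult_mono) auto
    then have eps: "\<epsilon> \<le> sqrt l ^ D * (3 * q) powr (- (real D / real m)) / (18 * (4 * (K / l ^ m) + 1))"
      using bound \<epsilon>(2) unfolding l_def K_def q_def by linarith
    have "removal_const \<epsilon> \<le> 1 / sqrt (K / real D) ^ D"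
      by (rule removal_property_upper_bound[OF D m(1) _ _ removal_const_greatest(1)[OF \<epsilon>(1)] eps[unfolded q_def]])
        (use K in \<open>simp_all add: K_def l_def q_def\<close>)
    also have "sqrt (K / real D) ^ D = (4/3) powr ((real D)\<^sup>2 / 4)"
    proof -
      have "K / real D = (4/3) powr (real D / 2)" using D by (simp add: K_def)
      moreover have "sqrt ((4/3) powr (real D / 2)) = (4/3) powr (real D / 4)"
        by (simp add: powr_powr flip: powr_half_sqrt)
      ultimately show ?thesis
        by (simp add: powr_powr power2_eq_square flip: powr_realpow)
    qed
    also have "1 / (4/3) powr ((real D)\<^sup>2 / 4) = (3/4 :: real) powr ((real D)\<^sup>2 / 4)"
      by (simp add: powr_divide)
    finally show "removal_const \<epsilon> \<le> (3/4) powr ((real D)\<^sup>2 / 4)" .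
  qed
qed

theorem theorem2:
  shows "\<exists>\<theta> :: real \<Rightarrow> real.
    (\<theta> \<longlongrightarrow> 0) (at_right 0) \<and>
    (\<forall>\<^sub>F \<epsilon> in at_right 0.
      removal_const \<epsilon> \<le> \<epsilon> powr ((1 / (4 * log 2 (4/3)) - \<theta> \<epsilon>) * log 2 (1 / \<epsilon>)))"
proof -
  define a where "a = log 2 (4/3 :: real)"
  have a: "0 < a" by (simp add: a_def)
  \<comment> \<open>The dimension, in terms of \<open>x = log 2 (1/\<epsilon>)\<close>: asymptotically \<open>x / a\<close>, lowered by enough to absorb
    the error term \<open>D powr (3/4)\<close> in \<open>removal_const_le_eventually\<close>.\<close>
  define d where "d = (\<lambda>x::real. nat \<lfloor>x / a - x powr (7/8)\<rfloor>)"
  define L where "L = (\<lambda>\<epsilon>::real. log 2 (1 / \<epsilon>))"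
  have L: "filterlim L at_top (at_right 0)" unfolding L_def by real_asymp
  define \<theta> where "\<theta> = (\<lambda>\<epsilon>. 1 / (4 * a) - a * (real (d (L \<epsilon>)) / L \<epsilon>)\<^sup>2 / 4)"
  have "((\<lambda>\<epsilon>. real (d (L \<epsilon>)) / L \<epsilon>) \<longlongrightarrow> inverse a) (at_right 0)"
    using filterlim_compose[OF dimension_tendsto[OF a] L] by (simp add: d_def)
  then have "(\<theta> \<longlongrightarrow> 1 / (4 * a) - a * (inverse a)\<^sup>2 / 4) (at_right 0)"
    unfolding \<theta>_def by (intro tendsto_intros) simp_all
  moreover have "1 / (4 * a) - a * (inverse a)\<^sup>2 / 4 = 0" using a by (simp add: field_simps power2_eq_square)
  ultimately have lim: "(\<theta> \<longlongrightarrow> 0) (at_right 0)" by simp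
  have ev1: "\<forall>\<^sub>F x::real in at_top. (x / a) powr (3/4) \<le> x powr (7/8)" using a by real_asymp
  have ev2: "\<forall>\<^sub>F x::real in at_top. 0 \<le> x / a - x powr (7/8)" using a by real_asymp
  have ev3: "\<forall>\<^sub>F \<epsilon>::real in at_right 0. \<epsilon> \<le> 1/9" by real_asymp
  have "\<forall>\<^sub>F \<epsilon> in at_right 0. removal_const \<epsilon> \<le> \<epsilon> powr ((1 / (4 * a) - \<theta> \<epsilon>) * log 2 (1 / \<epsilon>))"
    using filterlim_iff[THEN iffD1, OF filterlim_compose[OF dimension_filterlim[OF a] L], rule_format, OF removal_const_le_eventually]
      L[unfolded filterlim_iff, rule_format, OF ev1] L[unfolded filterlim_iff, rule_format, OF ev2]
      L[unfolded filterlim_iff, rule_format, OF eventually_gt_at_top[of 0]]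
      ev3 eventually_at_right_less[of 0]
  proof eventually_elim
    case (elim \<epsilon>)
    define x where "x = L \<epsilon>"
    define D where "D = real (d x)"
    have x: "0 < x" using elim by (simp add: x_def)
    have \<epsilon>: "\<epsilon> = 2 powr (- x)" using elim by (simp add: x_def L_def log_divide)
    have D: "0 \<le> D" "D \<le> x / a - x powr (7/8)"
      using elim(3) unfolding D_def d_def x_def[symmetric] by linarith+
    have "D powr (3/4) \<le> (x / a) powr (3/4)" using D a x by (intro powr_mono2) (auto intro: order_trans)
    also have "\<dots> \<le> x powr (7/8)" using elim(2) by (simp add: x_def)
    finally have "a * (D + D powr (3/4)) \<le> a * (x / a)" using D a by (intro mult_left_mono) auto
    then have le: "a * (D + D powr (3/4)) \<le> x" using a by simp
    have base: "(3/4) powr y = 2 powr (- (a * y))" for y :: real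
    proof -
      have "(4/3 :: real) = 2 powr a" by (simp add: a_def)
      then have "(3/4 :: real) = 2 powr (- a)" by (simp add: powr_minus divide_simps)
      then show ?thesis by (simp only: powr_powr) simp
    qed
    have "\<epsilon> \<le> (3/4) powr (D + D powr (3/4))" unfolding \<epsilon> base using le by simp
    then have "removal_const \<epsilon> \<le> (3/4) powr (D\<^sup>2 / 4)"
      using elim(1,5) by (simp add: D_def d_def x_def)
    also have "\<dots> = 2 powr (- x * (a * (D / x)\<^sup>2 / 4 * x))"
      unfolding base using x by (simp add: power2_eq_square)
    also have "\<dots> = \<epsilon> powr (a * (D / x)\<^sup>2 / 4 * x)"
      unfolding \<epsilon> by (simp add: powr_powr)
    also have "a * (D / x)\<^sup>2 / 4 * x = (1 / (4 * a) - \<theta> \<epsilon>) * log 2 (1 / \<epsilon>)"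
      by (simp add: \<theta>_def D_def x_def L_def)
    finally show ?case .
  qed
  then show ?thesis using lim unfolding a_def by blast
qed

end
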